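(* For every integer $n\ge 1$, $R(K_{1,n},F_n)=3n-\varepsilon$, where $\varepsilon=0$ if $n$ is odd and $\varepsilon=1$ if $n$ is even.
   Context: All graphs are finite, simple and undirected. For graphs $F$ and $H$, the Ramsey number $R(F,H)$ is the smallest integer $N$ such that every coloring of the edges of the complete graph $K_N$ with the two colors red and blue contains a red copy of $F$ or a blue copy of $H$ (as a subgraph, not necessarily induced). The star $K_{1,n}$ is the graph on $n+1$ vertices consisting of one center vertex adjacent to $n$ pairwise non-adjacent vertices. The fan $F_n$ is the graph on $2n+1$ vertices consisting of $n$ triangles that share exactly one common vertex (the center) and are otherwise vertex-disjoint; equivalently, a single vertex joined to all vertices of a disjoint union of $n$ copies of $K_2$. *)

theory Defs
  imports "HOL-Library.Ramsey"
begin

datatype 'a graph = Graph (verts: "'a set") (edges: "'a set set")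

definition simple_graph :: "'a graph \<Rightarrow> bool" where
  "simple_graph G \<longleftrightarrow> finite (verts G) \<and> edges G \<subseteq> [verts G]\<^bsup>2\<^esup>"

definition complete_graph :: "nat \<Rightarrow> nat graph" where
  "complete_graph N = Graph {..<N} ([{..<N}]\<^bsup>2\<^esup>)"

text \<open>Containment is as a subgraph, not necessarily induced: the embedding need not reflect
  non-adjacency.\<close>

definition contains_copy :: "'a graph \<Rightarrow> 'b graph \<Rightarrow> bool" where
  "contains_copy F G \<longleftrightarrow>
     (\<exists>f. inj_on f (verts F) \<and> f ` verts F \<subseteq> verts G \<and> (\<forall>e\<in>edges F. f ` e \<in> edges G))"

datatype colour = Red | Blue

text \<open>A colouring is a total function on sets of vertices, of which only the values on
  edges of the coloured graph matter.\<close>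

definition colour_class :: "'a graph \<Rightarrow> ('a set \<Rightarrow> colour) \<Rightarrow> colour \<Rightarrow> 'a graph" where
  "colour_class G c x = Graph (verts G) {e \<in> edges G. c e = x}"

definition arrows :: "nat \<Rightarrow> 'a graph \<Rightarrow> 'b graph \<Rightarrow> bool" where
  "arrows N F H \<longleftrightarrow>
     (\<forall>c. contains_copy F (colour_class (complete_graph N) c Red) \<or>
          contains_copy H (colour_class (complete_graph N) c Blue))"

definition ramsey_number :: "'a graph \<Rightarrow> 'b graph \<Rightarrow> nat" where
  "ramsey_number F H = (LEAST N. arrows N F H)"

definition star :: "nat \<Rightarrow> nat graph" where
  "star n = Graph {0..n} {{0, i} | i. i \<in> {1..n}}"

text \<open>The centre of the fan is \<open>0\<close>; its triangles are \<open>{0, 2 * i + 1, 2 * i + 2}\<close>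
  for \<open>i < n\<close>.\<close>

definition fan :: "nat \<Rightarrow> nat graph" where
  "fan n = Graph {0..2 * n}
     ({{0, j} | j. j \<in> {1..2 * n}} \<union> {{2 * i + 1, 2 * i + 2} | i. i < n})"

lemma simple_graph_complete_graph: "simple_graph (complete_graph N)"
  by (simp add: simple_graph_def complete_graph_def)

lemma simple_graph_star: "simple_graph (star n)"
  by (auto simp: simple_graph_def star_def nsets_def)

lemma simple_graph_fan: "simple_graph (fan n)"
  by (auto simp: simple_graph_def fan_def nsets_def card_insert_if)

end

theory Submission
  imports Defs
begin

text \<open>A colouring of \<open>K\<^sub>N\<close> has no red \<open>K\<^sub>1\<^sub>,\<^sub>n\<close> exactly when all red degrees are below \<open>n\<close>. The
  point of the theorem is that, under this condition, a blue \<open>F\<^sub>n\<close> exists as soon as its centre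
  has enough room: if \<open>v\<close> has at least \<open>2 n\<close> blue neighbours, choose \<open>2 n\<close> of them; inside this set
  every vertex still has at least \<open>2 n - 1 - (n - 1) = n\<close> blue neighbours, so the degree condition
  of Dirac's theorem on Hamiltonian cycles gives a perfect matching (\<open>dirac_perfect_matching\<close>), whose \<open>n\<close> edges form with
  \<open>v\<close> the triangles of the fan. Hence avoiding both graphs means that all red degrees are at most
  \<open>n - 1\<close> and all blue degrees at most \<open>2 n - 1\<close>. The two degrees at a vertex add up to \<open>N - 1\<close>, so
  this forces \<open>N \<le> 3 n - 1\<close>.

  If \<open>N = 3 n - 1\<close>, the red graph must be \<open>(n - 1)\<close>-regular. For even \<open>n\<close> both the degree and the
  number of vertices are then odd, which the handshake lemma (\<open>even_sum_degrees\<close>) excludes; this is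
  the source of the parity term. Conversely, circulant red graphs of degree \<open>2 \<lfloor>(n - 1) / 2\<rfloor>\<close>
  (\<open>circulant_colouring\<close>) on \<open>3 n - 1\<close> vertices for odd \<open>n\<close>, and on \<open>3 n - 2\<close> vertices for even \<open>n\<close>,
  satisfy both degree bounds. For even \<open>n\<close> there is a slack of one, which is why circulants of even
  degree suffice there too.\<close>

section \<open>Perfect matchings under Dirac's degree condition\<close>

text \<open>A matching with \<open>m\<close> edges is an injective sequence \<open>g\<close> of length \<open>2 m\<close> whose consecutive
  entries \<open>g (2 i)\<close>, \<open>g (2 i + 1)\<close> are adjacent; this is the form in which the fan consumes it.\<close>

definition matching_seq :: "('a \<Rightarrow> 'a \<Rightarrow> bool) \<Rightarrow> 'a set \<Rightarrow> nat \<Rightarrow> (nat \<Rightarrow> 'a) \<Rightarrow> bool" where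
  "matching_seq adj A m g \<longleftrightarrow>
     inj_on g {..<2*m} \<and> g ` {..<2*m} \<subseteq> A \<and> (\<forall>i<m. adj (g (2*i)) (g (2*i+1)))"

lemma matching_seq_append:
  assumes "matching_seq adj A m g" "x \<in> A - g ` {..<2*m}" "y \<in> A - g ` {..<2*m}"
    "x \<noteq> y" "adj x y"
  shows "matching_seq adj A (Suc m) (g(2*m := x, 2*m+1 := y))"
proof -
  let ?h = "g(2*m := x, 2*m+1 := y)"
  have dom: "{..<2 * Suc m} = insert (2*m+1) (insert (2*m) {..<2*m})" by auto
  have old: "?h j = g j" if "j < 2*m" for j using that by simp
  have img: "?h ` {..<2*m} = g ` {..<2*m}" using old by (intro image_cong) auto
  have "inj_on ?h {..<2*m}"
    using assms(1) old by (simp add: matching_seq_def inj_on_def)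
  moreover have "?h (2*m) = x" "?h (2*m+1) = y" by auto
  ultimately have "inj_on ?h {..<2 * Suc m}"
    using assms(2-4) img unfolding dom inj_on_insert by auto
  moreover have "?h ` {..<2 * Suc m} \<subseteq> A"
    using assms(1-3) img unfolding dom image_insert by (auto simp: matching_seq_def)
  moreover have "adj (?h (2*i)) (?h (2*i+1))" if "i < Suc m" for i
    using that assms(1,5) by (cases "i = m") (auto simp: matching_seq_def)
  ultimately show ?thesis by (simp add: matching_seq_def)
qed

text \<open>Moving the edge at position \<open>i\<close> from \<open>g (2 i + 1)\<close> to \<open>x\<close> frees \<open>g (2 i + 1)\<close>, which is then
  available for a further edge.\<close>

lemma matching_seq_replace:
  assumes "matching_seq adj A m g" "i < m" "x \<in> A - g ` {..<2*m}" "adj (g (2*i)) x"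
  shows "matching_seq adj A m (g(2*i+1 := x))"
    and "g (2*i+1) \<notin> (g(2*i+1 := x)) ` {..<2*m}"
proof -
  have inj: "inj_on g {..<2*m}" using assms(1) by (simp add: matching_seq_def)
  have x: "x \<noteq> g j" if "j < 2*m" for j using assms(3) that by auto
  have "inj_on (g(2*i+1 := x)) {..<2*m}"
    using inj x by (auto simp: inj_on_def)
  moreover have "adj ((g(2*i+1 := x)) (2*j)) ((g(2*i+1 := x)) (2*j+1))" if "j < m" for j
  proof -
    have "2*j \<noteq> 2*i+1" by presburger
    then show ?thesis using assms(1,4) that by (cases "j = i") (auto simp: matching_seq_def)
  qed
  ultimately show "matching_seq adj A m (g(2*i+1 := x))"
    using assms(1,3) by (auto simp: matching_seq_def)
  have "2*i+1 < 2*m" using assms(2) by simp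
  then show "g (2*i+1) \<notin> (g(2*i+1 := x)) ` {..<2*m}"
    using inj x by (auto simp: inj_on_def)
qed

text \<open>Let \<open>x\<close> and \<open>y\<close> be unmatched. If an unmatched vertex has an unmatched neighbour, that edge can
  be added. Otherwise both send all their edges into the \<open>m < n\<close> matching edges, so by counting some
  matching edge \<open>ab\<close> has \<open>a\<close> adjacent to \<open>x\<close> and \<open>b\<close> adjacent to \<open>y\<close>, and \<open>ab\<close> can be traded for
  \<open>ax\<close> and \<open>by\<close>.\<close>

lemma matching_seq_augment:
  assumes sym: "\<And>x y. adj x y \<Longrightarrow> adj y x" and irrefl: "\<And>x. \<not> adj x x"
    and A: "finite A" "card A = 2*n"
    and deg: "\<And>x. x \<in> A \<Longrightarrow> n \<le> card {y \<in> A. adj x y}"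
    and g: "matching_seq adj A m g" and "m < n"
  shows "\<exists>h. matching_seq adj A (Suc m) h"
proof (cases "\<exists>x \<in> A - g ` {..<2*m}. \<exists>y \<in> A - g ` {..<2*m}. adj x y")
  case True
  then show ?thesis using matching_seq_append[OF g] irrefl by metis
next
  case False
  have inj: "inj_on g {..<2*m}" and sub: "g ` {..<2*m} \<subseteq> A"
    using g by (auto simp: matching_seq_def)
  have "card (g ` {..<2*m}) = 2*m" using inj by (simp add: card_image)
  then have "2 \<le> card (A - g ` {..<2*m})"
    using A sub \<open>m < n\<close> by (simp add: card_Diff_subset)
  then obtain S where "S \<subseteq> A - g ` {..<2*m}" "card S = 2"
    by (rule obtain_subset_with_card_n)
  then obtain x y where xy: "x \<in> A - g ` {..<2*m}" "y \<in> A - g ` {..<2*m}" "x \<noteq> y"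
    by (auto simp: card_2_iff)
  define D where "D z = {j. j < 2*m \<and> adj z (g j)}" for z
  have D: "n \<le> card (D z)" if "z \<in> A - g ` {..<2*m}" for z
  proof -
    have "{w \<in> A. adj z w} \<subseteq> g ` D z" using False that by (auto simp: D_def)
    then have "card {w \<in> A. adj z w} \<le> card (D z)"
      by (rule surj_card_le[rotated]) (simp add: D_def)
    then show ?thesis using deg[of z] that by auto
  qed
  \<comment> \<open>the partner of a position inside its matching edge\<close>
  define p where "p j = (if even j then j + 1 else j - 1)" for j :: nat
  have pp: "p (p j) = j" for j by (auto simp: p_def)
  have plt: "p j < 2*m" if "j < 2*m" for j
    using that unfolding p_def by presburger
  have "D x \<inter> p ` D y \<noteq> {}"
  proof
    assume disj: "D x \<inter> p ` D y = {}"
    have "card (D x) + card (p ` D y) = card (D x \<union> p ` D y)"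
      by (rule card_Un_disjoint[symmetric]) (use disj in \<open>auto simp: D_def\<close>)
    also have "\<dots> \<le> card {..<2*m}" by (rule card_mono) (use plt in \<open>auto simp: D_def\<close>)
    finally have "card (D x) + card (D y) \<le> 2*m"
      using card_image[of p "D y"] pp by (metis card_lessThan inj_on_inverseI)
    then show False using D[OF xy(1)] D[OF xy(2)] \<open>m < n\<close> by linarith
  qed
  then obtain j where j: "j < 2*m" "adj y (g j)" "adj x (g (p j))"
    by (auto simp: D_def)
  \<comment> \<open>only the order of \<open>x\<close> and \<open>y\<close> depends on the parity of \<open>j\<close>\<close>
  obtain i u w where i: "i < m" "adj (g (2*i)) u" "adj (g (2*i+1)) w"
    and uw: "u \<in> A - g ` {..<2*m}" "w \<in> A - g ` {..<2*m}" "u \<noteq> w"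
  proof (cases "even j")
    case True
    then obtain i where "j = 2*i" by (auto elim: evenE)
    then show ?thesis using that[of i y x] j xy sym by (auto simp: p_def)
  next
    case False
    then obtain i where "j = 2*i+1" by (auto elim: oddE)
    then show ?thesis using that[of i x y] j xy sym by (auto simp: p_def)
  qed
  let ?g = "g(2*i+1 := u)"
  note r = matching_seq_replace[OF g i(1) uw(1) i(2)]
  have "2*i+1 < 2*m" using i(1) by simp
  then have "g (2*i+1) \<in> A" "g (2*i+1) \<noteq> w" using sub uw(2) by auto
  moreover have "w \<notin> ?g ` {..<2*m}" using uw by auto
  ultimately show ?thesis
    using matching_seq_append[OF r(1), of "g (2*i+1)" w] r(2) uw(2) i(3) by blast
qed

theorem dirac_perfect_matching:
  assumes "\<And>x y. adj x y \<Longrightarrow> adj y x" "\<And>x. \<not> adj x x"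
    and "finite A" "card A = 2*n"
    and "\<And>x. x \<in> A \<Longrightarrow> n \<le> card {y \<in> A. adj x y}"
  shows "\<exists>g. matching_seq adj A n g"
proof -
  \<comment> \<open>a matching with fewer than \<open>n\<close> edges can always be enlarged\<close>
  have "\<exists>g. matching_seq adj A m g" if "m \<le> n" for m
    using that
  proof (induction m)
    case 0
    then show ?case by (simp add: matching_seq_def)
  next
    case (Suc m)
    then obtain g where "matching_seq adj A m g" by auto
    with Suc.prems show ?case
      using matching_seq_augment[of adj A n m g] assms by auto
  qed
  then show ?thesis by simp
qed

section \<open>The handshake lemma\<close>

lemma even_sum_degrees:
  assumes "finite V" and sym: "\<And>x y. adj x y \<Longrightarrow> adj y x" and irrefl: "\<And>x. \<not> adj x x"
  shows "even (\<Sum>v\<in>V. card {u \<in> V. adj v u})"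
  using \<open>finite V\<close>
proof induction
  case empty
  show ?case by simp
next
  case (insert a V)
  have a: "{u \<in> insert a V. adj a u} = {u \<in> V. adj a u}" using irrefl by auto
  have "card {u \<in> insert a V. adj v u} = card {u \<in> V. adj v u} + of_bool (adj v a)" for v
  proof (cases "adj v a")
    case True
    then have "{u \<in> insert a V. adj v u} = insert a {u \<in> V. adj v u}" by auto
    with True insert.hyps show ?thesis by simp
  next
    case False
    then have "{u \<in> insert a V. adj v u} = {u \<in> V. adj v u}" by auto
    with False show ?thesis by simp
  qed
  then have "(\<Sum>v\<in>V. card {u \<in> insert a V. adj v u}) =
      (\<Sum>v\<in>V. card {u \<in> V. adj v u}) + (\<Sum>v\<in>V. of_bool (adj v a))"
    by (simp add: sum.distrib)
  also have "(\<Sum>v\<in>V. of_bool (adj v a)) = card {v \<in> V. adj a v}"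
  proof -
    have "V \<inter> {v. adj v a} = {v \<in> V. adj a v}" using sym by auto
    then show ?thesis using insert.hyps by simp
  qed
  finally have "(\<Sum>v\<in>insert a V. card {u \<in> insert a V. adj v u}) =
      (\<Sum>v\<in>V. card {u \<in> V. adj v u}) + 2 * card {v \<in> V. adj a v}"
    using insert.hyps a by simp
  with insert.IH show ?case by simp
qed

section \<open>Stars and fans in terms of degrees\<close>

definition neighbours :: "'a graph \<Rightarrow> 'a \<Rightarrow> 'a set" where
  "neighbours G v = {u \<in> verts G. {v, u} \<in> edges G}"

lemma simple_graph_no_loop: "simple_graph G \<Longrightarrow> {v} \<notin> edges G"
  by (auto simp: simple_graph_def nsets_def)

lemma finite_neighbours: "simple_graph G \<Longrightarrow> finite (neighbours G v)"
  by (simp add: simple_graph_def neighbours_def)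

lemma contains_copy_mono:
  assumes "contains_copy F G" "verts G \<subseteq> verts G'" "edges G \<subseteq> edges G'"
  shows "contains_copy F G'"
proof -
  obtain f where "inj_on f (verts F)" "f ` verts F \<subseteq> verts G" "\<forall>e\<in>edges F. f ` e \<in> edges G"
    using assms(1) unfolding contains_copy_def by (elim exE conjE)
  with assms(2,3) show ?thesis
    unfolding contains_copy_def by (intro exI[of _ f] conjI ballI) (auto dest: subsetD)
qed

lemma contains_star_iff:
  assumes G: "simple_graph G"
  shows "contains_copy (star k) G \<longleftrightarrow> (\<exists>v \<in> verts G. k \<le> card (neighbours G v))"
proof
  assume "contains_copy (star k) G"
  then obtain f where f: "inj_on f {0..k}" "f ` {0..k} \<subseteq> verts G"
    and e: "\<forall>e\<in>{{0, i} | i. i \<in> {1..k}}. f ` e \<in> edges G"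
    by (auto simp: contains_copy_def star_def)
  have "f ` {1..k} \<subseteq> neighbours G (f 0)"
  proof
    fix u assume "u \<in> f ` {1..k}"
    then obtain i where i: "i \<in> {1..k}" "u = f i" by blast
    then have "f ` {0, i} \<in> edges G" using e by blast
    with f(2) i show "u \<in> neighbours G (f 0)" by (auto simp: neighbours_def)
  qed
  then have "card (f ` {1..k}) \<le> card (neighbours G (f 0))"
    by (rule card_mono[OF finite_neighbours[OF G]])
  moreover have "card (f ` {1..k}) = k"
    using inj_on_subset[OF f(1), of "{1..k}"] by (simp add: card_image)
  moreover have "f 0 \<in> verts G" using f(2) by auto
  ultimately show "\<exists>v \<in> verts G. k \<le> card (neighbours G v)" by auto
next
  assume "\<exists>v \<in> verts G. k \<le> card (neighbours G v)"
  then obtain v W where v: "v \<in> verts G" and W: "W \<subseteq> neighbours G v" "card W = k" "finite W"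
    by (metis obtain_subset_with_card_n)
  obtain h where h: "bij_betw h {1..k} W"
    using W finite_same_card_bij[of "{1..k}" W] by auto
  have "v \<notin> W" using W(1) simple_graph_no_loop[OF G, of v] by (auto simp: neighbours_def)
  define f where "f = h(0 := v)"
  have fh: "f i = h i" if "i \<in> {1..k}" for i using that by (auto simp: f_def)
  then have img: "f ` {1..k} = W" using h by (auto simp: bij_betw_def)
  have f0: "f 0 = v" by (simp add: f_def)
  have dom: "{0..k} = insert 0 {1..k}" by auto
  have "inj_on f {1..k}" using h fh inj_on_cong[of "{1..k}" f h] by (simp add: bij_betw_def)
  moreover have "f 0 \<notin> f ` ({1..k} - {0})" using img f0 \<open>v \<notin> W\<close> by auto
  ultimately have "inj_on f {0..k}" unfolding dom by simp
  moreover have "f ` {0..k} \<subseteq> verts G"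
    using img W(1) v unfolding dom by (auto simp: neighbours_def f0)
  moreover have "f ` {0, i} \<in> edges G" if "i \<in> {1..k}" for i
  proof -
    have "f i \<in> neighbours G v" using img W(1) that by blast
    then show ?thesis by (simp add: neighbours_def f0)
  qed
  ultimately show "contains_copy (star k) G"
    unfolding contains_copy_def star_def by (intro exI[of _ f]) auto
qed

lemma contains_fan_imp_star: "contains_copy (fan n) G \<Longrightarrow> contains_copy (star (2*n)) G"
proof -
  have "verts (star (2*n)) = verts (fan n)" "edges (star (2*n)) \<subseteq> edges (fan n)"
    by (auto simp: star_def fan_def)
  then show "contains_copy (fan n) G \<Longrightarrow> contains_copy (star (2*n)) G"
    unfolding contains_copy_def by (metis subsetD)
qed

lemma contains_fan_if_dirac:
  assumes G: "simple_graph G" and v: "v \<in> verts G"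
    and W: "W \<subseteq> neighbours G v" "card W = 2*n"
    and deg: "\<And>w. w \<in> W \<Longrightarrow> n \<le> card {u \<in> W. {w, u} \<in> edges G}"
  shows "contains_copy (fan n) G"
proof -
  have "finite W" using W(1) finite_neighbours[OF G] by (rule finite_subset)
  then obtain g where "matching_seq (\<lambda>x y. {x, y} \<in> edges G) W n g"
    using dirac_perfect_matching[of "\<lambda>x y. {x, y} \<in> edges G" W n] W(2) deg
      simple_graph_no_loop[OF G] by (auto simp: insert_commute)
  then have g: "inj_on g {..<2*n}" "g ` {..<2*n} \<subseteq> W"
      "\<And>i. i < n \<Longrightarrow> {g (2*i), g (2*i+1)} \<in> edges G"
    by (auto simp: matching_seq_def)
  have "v \<notin> W" using W(1) simple_graph_no_loop[OF G, of v] by (auto simp: neighbours_def)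
  define f where "f = case_nat v g"
  have f: "f 0 = v" "f (Suc j) = g j" for j by (auto simp: f_def)
  have dom: "{0..2*n} = insert 0 (Suc ` {..<2*n})"
    by (metis atMost_atLeast0 lessThan_Suc_atMost lessThan_Suc_eq_insert_0)
  have img: "f ` Suc ` {..<2*n} = g ` {..<2*n}" by (simp add: image_image f)
  have "inj_on f (Suc ` {..<2*n})" using g(1) by (auto simp: inj_on_def f)
  then have "inj_on f {0..2*n}"
    unfolding dom inj_on_insert using img g(2) \<open>v \<notin> W\<close> by (auto simp: f)
  moreover have "f ` {0..2*n} \<subseteq> verts G"
    unfolding dom image_insert img using g(2) W(1) v by (auto simp: f neighbours_def)
  moreover have "f ` {0, j} \<in> edges G" if "j \<in> {1..2*n}" for j
  proof -
    obtain i where "j = Suc i" "i < 2*n" using \<open>j \<in> {1..2*n}\<close> by (cases j) auto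
    then have "f j \<in> neighbours G v" using g(2) W(1) by (auto simp: f)
    then show ?thesis by (simp add: neighbours_def f)
  qed
  moreover have "f ` {2*i+1, 2*i+2} \<in> edges G" if "i < n" for i
    using g(3)[OF that] by (simp add: f)
  ultimately show ?thesis
    unfolding contains_copy_def fan_def by (intro exI[of _ f]) auto
qed

section \<open>Coloured complete graphs\<close>

lemma not_Red_iff: "x \<noteq> Red \<longleftrightarrow> x = Blue"
  by (cases x) auto

abbreviation coloured :: "nat \<Rightarrow> (nat set \<Rightarrow> colour) \<Rightarrow> colour \<Rightarrow> nat graph" where
  "coloured N c x \<equiv> colour_class (complete_graph N) c x"

lemma simple_graph_coloured: "simple_graph (coloured N c x)"
  by (auto simp: simple_graph_def colour_class_def complete_graph_def)

lemma verts_coloured [simp]: "verts (coloured N c x) = {..<N}"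
  by (simp add: colour_class_def complete_graph_def)

lemma edge_coloured_iff:
  "{v, u} \<in> edges (coloured N c x) \<longleftrightarrow> v < N \<and> u < N \<and> u \<noteq> v \<and> c {v, u} = x"
  by (auto simp: colour_class_def complete_graph_def nsets_def card_insert_if)

lemma neighbours_coloured:
  "v < N \<Longrightarrow> neighbours (coloured N c x) v = {u. u < N \<and> u \<noteq> v \<and> c {v, u} = x}"
  by (auto simp: neighbours_def edge_coloured_iff)

lemma card_neighbours_coloured:
  assumes "v < N"
  shows "card (neighbours (coloured N c Red) v) + card (neighbours (coloured N c Blue) v) = N - 1"
proof -
  have "neighbours (coloured N c Red) v \<union> neighbours (coloured N c Blue) v = {..<N} - {v}"
    using assms by (auto simp flip: not_Red_iff simp: neighbours_coloured)
  moreover have "neighbours (coloured N c Red) v \<inter> neighbours (coloured N c Blue) v = {}"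
    using assms by (auto simp: neighbours_coloured)
  ultimately show ?thesis
    using assms card_Un_disjoint[of "neighbours (coloured N c Red) v"
        "neighbours (coloured N c Blue) v"]
    by (simp add: finite_neighbours simple_graph_coloured)
qed

lemma arrows_mono:
  assumes "arrows M F H" "M \<le> N"
  shows "arrows N F H"
proof -
  have "edges (coloured M c x) \<subseteq> edges (coloured N c x)" for c x
    using assms(2) by (auto simp: colour_class_def complete_graph_def nsets_def)
  moreover have "verts (coloured M c x) \<subseteq> verts (coloured N c x)" for c x
    using assms(2) by simp
  ultimately have
    "contains_copy F (coloured M c x) \<Longrightarrow> contains_copy F (coloured N c x)"
    "contains_copy H (coloured M c x) \<Longrightarrow> contains_copy H (coloured N c x)" for c x
    using contains_copy_mono[of F "coloured M c x" "coloured N c x"]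
      contains_copy_mono[of H "coloured M c x" "coloured N c x"] by blast+
  then show ?thesis using assms(1) unfolding arrows_def by blast
qed

section \<open>The upper bound\<close>

lemma blue_fan_if_red_degrees_small:
  assumes red: "\<And>u. u < N \<Longrightarrow> card (neighbours (coloured N c Red) u) < n"
    and v: "v < N" "2*n \<le> card (neighbours (coloured N c Blue) v)"
  shows "contains_copy (fan n) (coloured N c Blue)"
proof -
  obtain W where W: "W \<subseteq> neighbours (coloured N c Blue) v" "card W = 2*n" "finite W"
    by (rule obtain_subset_with_card_n[OF v(2)])
  have "n \<le> card {u \<in> W. {w, u} \<in> edges (coloured N c Blue)}" if "w \<in> W" for w
  proof -
    let ?B = "{u \<in> W. {w, u} \<in> edges (coloured N c Blue)}"
    let ?R = "neighbours (coloured N c Red) w"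
    have WN: "W \<subseteq> {..<N}" using W(1) by (auto simp: neighbours_def)
    then have w: "w < N" using that by auto
    have "W - {w} \<subseteq> ?B \<union> ?R"
      using WN w by (auto simp flip: not_Red_iff simp: neighbours_coloured edge_coloured_iff)
    then have "card (W - {w}) \<le> card (?B \<union> ?R)"
      by (rule card_mono[rotated])
        (use W(3) in \<open>simp add: finite_neighbours simple_graph_coloured\<close>)
    also have "\<dots> \<le> card ?B + card ?R" by (rule card_Un_le)
    finally have "2*n - 1 \<le> card ?B + card ?R" using that W by simp
    with red[OF w] show ?thesis by linarith
  qed
  with W v(1) show ?thesis
    by (intro contains_fan_if_dirac[OF simple_graph_coloured]) auto
qed

lemma arrows_star_fanI:
  assumes "\<And>c. (\<And>u. u < N \<Longrightarrow> card (neighbours (coloured N c Red) u) < n) \<Longrightarrow>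
      \<exists>v<N. 2*n \<le> card (neighbours (coloured N c Blue) v)"
  shows "arrows N (star n) (fan n)"
  unfolding arrows_def
proof
  fix c
  show "contains_copy (star n) (coloured N c Red) \<or> contains_copy (fan n) (coloured N c Blue)"
  proof (cases "\<exists>v<N. n \<le> card (neighbours (coloured N c Red) v)")
    case True
    then show ?thesis by (auto simp: contains_star_iff[OF simple_graph_coloured])
  next
    case False
    then have red: "card (neighbours (coloured N c Red) u) < n" if "u < N" for u
      using that by (meson not_le)
    then obtain v where "v < N" "2*n \<le> card (neighbours (coloured N c Blue) v)"
      using assms[of c] by blast
    with red show ?thesis using blue_fan_if_red_degrees_small[of N c n v] by simp
  qed
qed

lemma arrows_star_fan_3n:
  assumes "n \<ge> 1"
  shows "arrows (3*n) (star n) (fan n)"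
proof (rule arrows_star_fanI)
  fix c
  assume "\<And>u. u < 3*n \<Longrightarrow> card (neighbours (coloured (3*n) c Red) u) < n"
  from this[of 0] show "\<exists>v<3*n. 2*n \<le> card (neighbours (coloured (3*n) c Blue) v)"
    using assms card_neighbours_coloured[of 0 "3*n" c] by (intro exI[of _ 0]) auto
qed

text \<open>If all red degrees are below \<open>n\<close> and all blue degrees below \<open>2 n\<close>, then every red degree is \<open>n - 1\<close>, and the red degrees have
  the odd sum \<open>(3 n - 1) (n - 1)\<close>.\<close>

lemma arrows_star_fan_even:
  assumes "n \<ge> 1" "even n"
  shows "arrows (3*n - 1) (star n) (fan n)"
proof (rule arrows_star_fanI, rule ccontr)
  fix c
  let ?N = "3*n - 1"
  assume red: "\<And>u. u < ?N \<Longrightarrow> card (neighbours (coloured ?N c Red) u) < n"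
  assume blue: "\<not> (\<exists>v<?N. 2*n \<le> card (neighbours (coloured ?N c Blue) v))"
  have "card (neighbours (coloured ?N c Red) v) = n - 1" if "v < ?N" for v
    using red[OF that] blue that card_neighbours_coloured[OF that, of c] by force
  moreover have "even (\<Sum>v<?N. card (neighbours (coloured ?N c Red) v))"
    using even_sum_degrees[of "{..<?N}" "\<lambda>v u. {v, u} \<in> edges (coloured ?N c Red)"]
      simple_graph_no_loop[OF simple_graph_coloured]
    by (auto simp: neighbours_def insert_commute)
  ultimately have "even (?N * (n - 1))" by simp
  with assms show False by simp
qed

section \<open>The lower bound\<close>

lemma inj_on_add_mod: "inj_on (\<lambda>d. (v + d) mod N) {..<N::nat}"
proof (rule inj_onI)
  fix d e assume "d \<in> {..<N}" "e \<in> {..<N}" "(v + d) mod N = (v + e) mod N"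
  then have "int d mod int N = int e mod int N"
    by (metis mod_diff_left_eq add_diff_cancel_left' of_nat_add of_nat_mod)
  with \<open>d \<in> {..<N}\<close> \<open>e \<in> {..<N}\<close> show "d = e" by simp
qed

text \<open>Closure of \<open>D\<close> under \<open>d \<mapsto> N - d\<close>, that is negation modulo \<open>N\<close>, makes adjacency symmetric, so
  that no neighbours other than the translates \<open>v + d\<close> arise.\<close>

lemma circulant_colouring:
  assumes D: "D \<subseteq> {0<..<N}" and neg: "\<And>d. d \<in> D \<Longrightarrow> N - d \<in> D"
  shows "\<exists>c. \<forall>v<N. card (neighbours (coloured N c Red) v) = card D"
proof -
  define c where
    "c e = (if \<exists>u<N. \<exists>d\<in>D. e = {u, (u + d) mod N} then Red else Blue)" for e
  have "card (neighbours (coloured N c Red) v) = card D" if v: "v < N" for v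
  proof -
    have inverse_step: "((u + d) mod N + (N - d)) mod N = u" if "u < N" "d \<in> D" for u d
    proof -
      have "d < N" using D that(2) by auto
      have "((u + d) mod N + (N - d)) mod N = (u + d + (N - d)) mod N"
        by (rule mod_add_left_eq)
      also have "u + d + (N - d) = u + N" using \<open>d < N\<close> by simp
      finally show ?thesis using that(1) by simp
    qed
    have inj: "inj_on (\<lambda>d. (v + d) mod N) {..<N}" by (rule inj_on_add_mod)
    have ne: "(v + d) mod N \<noteq> v" if "d \<in> D" for d
      using inj_onD[OF inj, of d 0] D v that by auto
    have "neighbours (coloured N c Red) v = (\<lambda>d. (v + d) mod N) ` D"
    proof (intro equalityI subsetI)
      fix u assume "u \<in> neighbours (coloured N c Red) v"
      then obtain w d where "w < N" "d \<in> D" "{v, u} = {w, (w + d) mod N}"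
        using v by (auto simp: neighbours_coloured c_def split: if_splits)
      then consider "u = (v + d) mod N" | "u = (v + (N - d)) mod N"
        using inverse_step[of w d] unfolding doubleton_eq_iff by metis
      then show "u \<in> (\<lambda>d. (v + d) mod N) ` D"
        by cases (use \<open>d \<in> D\<close> neg[of d] in blast)+
    next
      fix u assume "u \<in> (\<lambda>d. (v + d) mod N) ` D"
      then obtain d where d: "d \<in> D" "u = (v + d) mod N" by auto
      then have "c {v, u} = Red" using v by (auto simp: c_def)
      with d v ne[of d] show "u \<in> neighbours (coloured N c Red) v"
        by (simp add: neighbours_coloured)
    qed
    moreover have "inj_on (\<lambda>d. (v + d) mod N) D"
      by (rule inj_on_subset[OF inj]) (use D in auto)
    ultimately show ?thesis by (simp add: card_image)
  qed
  then show ?thesis by blast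
qed

lemma even_regular_colouring:
  assumes "2*k < N"
  shows "\<exists>c. \<forall>v<N. card (neighbours (coloured N c Red) v) = 2*k"
proof -
  \<comment> \<open>the residues of \<open>\<plusminus>1, \<dots>, \<plusminus>k\<close>, which are distinct because \<open>2 k < N\<close>\<close>
  let ?D = "{1..k} \<union> {N-k..<N}"
  have "card ?D = card {1..k} + card {N-k..<N}"
    by (rule card_Un_disjoint) (use assms in auto)
  then have "card ?D = 2*k" using assms by simp
  moreover have "?D \<subseteq> {0<..<N}" using assms by auto
  moreover have "N - d \<in> ?D" if "d \<in> ?D" for d using that assms by auto
  ultimately show ?thesis using circulant_colouring[of ?D N] by metis
qed

text \<open>The last hypothesis says that the blue degree \<open>N - 1 - 2 k\<close> is below \<open>2 n\<close>, the degree of the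
  centre of the fan.\<close>

lemma not_arrows_star_fan:
  assumes "2*k < n" "2*k < N" "N \<le> 2*n + 2*k"
  shows "\<not> arrows N (star n) (fan n)"
proof -
  obtain c where c: "\<And>v. v < N \<Longrightarrow> card (neighbours (coloured N c Red) v) = 2*k"
    using even_regular_colouring[OF assms(2)] by blast
  have "\<not> contains_copy (star n) (coloured N c Red)"
    using c assms(1) by (auto simp: contains_star_iff[OF simple_graph_coloured])
  moreover have "card (neighbours (coloured N c Blue) v) < 2*n" if "v < N" for v
    using c[OF that] card_neighbours_coloured[OF that, of c] assms that by linarith
  then have "\<not> contains_copy (fan n) (coloured N c Blue)"
    by (metis contains_fan_imp_star contains_star_iff lessThan_iff not_le
        simple_graph_coloured verts_coloured)
  ultimately show ?thesis unfolding arrows_def by blast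
qed

theorem theorem1p2:
  fixes n :: nat
  assumes "n \<ge> 1"
  shows "ramsey_number (star n) (fan n) = 3 * n - (if odd n then 0 else 1)"
  unfolding ramsey_number_def
proof (rule Least_equality)
  show "arrows (3 * n - (if odd n then 0 else 1)) (star n) (fan n)"
    using arrows_star_fan_3n arrows_star_fan_even assms by simp
next
  fix M assume M: "arrows M (star n) (fan n)"
  let ?N = "3 * n - (if odd n then 0 else 1)" and ?k = "(n - 1) div 2"
  have "\<not> arrows (?N - 1) (star n) (fan n)"
  proof (rule not_arrows_star_fan[of ?k])
    show "2 * ?k < n" "2 * ?k < ?N - 1" using assms by auto
    show "?N - 1 \<le> 2 * n + 2 * ?k" using assms by presburger
  qed
  with M have "\<not> M \<le> ?N - 1" using arrows_mono by blast
  then show "?N \<le> M" by linarith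
qed

end
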